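(* There is an absolute constant $c$ such that the following holds in the measured reduced single-loop model of the context. For every pattern $n$ of weight $k=\sum_t|n_t|\ge1$ and every $\epsilon\in(0,1)$ there exist guard-compatible settings and an estimator $\hat E$, a polynomial of degree $k$ in the measured FIR-deconvolved features $\hat g_j$ and their conjugates, whose root-mean-square error satisfies $\big(\mathbb E|\hat E-E_n(s)|^2\big)^{1/2}\le\epsilon$ uniformly over all inputs $s\in\mathcal U$, at per-feature shot budget $$B\ \le\ c\,\Big(\frac{\sigma_{\rm eff}}{\mu_T}\Big)^2k^3\,(1+v_\infty)^{3(k-1)}\,\epsilon^{-3}.$$
   Context: Fix $\eta\in(0,1)$, $\beta,s_{\max}>0$ with $0<\beta s_{\max}<\pi$. $\mathcal U=[-s_{\max},s_{\max}]^{\mathbb Z_{\le0}}$. A guard-compatible setting is a mask $\varphi=(\varphi_t)_{t\le0}$ of real phases and an $r>0$ with $\bar\rho=\eta e^{2r}<1$. With $\theta_t=\varphi_t+\beta s_t$, $(m_t,\bar m_t,J_t)^\top=v_t$ is the unique bounded solution of $v_t=T(\theta_t)v_{t-1}+b_{\rm vac}$, $b_{\rm vac}=(0,0,\tfrac{1-\eta}2)^\top$, $$T(\theta)=\eta\begin{pmatrix}\cosh^2 r& e^{2i\theta}\sinh^2 r&-e^{i\theta}\sinh 2r\\ e^{-2i\theta}\sinh^2 r&\cosh^2 r&-e^{-i\theta}\sinh2r\\ -\tfrac12e^{-i\theta}\sinh2r&-\tfrac12e^{i\theta}\sinh2r&\cosh2r\end{pmatrix}.$$ A pattern is a finitely supported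 $n:\mathbb Z_{\le0}\to\mathbb Z$; $E_n(s)=\prod_te^{i\beta n_ts_t}$. $v_\infty=\frac{1-\eta}{2(1-\bar\rho)}$ at the chosen setting. **Measurement.** With $\sigma_{\rm eff}>0$ the per-shot readout deviation, $\mu_T>0$ the transduction gain and $B$ the number of shots per feature, the detector returns $\hat m_j=m_j+\zeta_j$ with $\zeta_j$ independent centered complex Gaussian, $\mathbb E|\zeta_j|^2=\sigma_{\rm eff}^2/(\mu_T^2B)$. The measured FIR-deconvolved feature is $\hat g_j=\dfrac{\hat m_j-x\,\hat m_{j-1}}{\varkappa\,e^{i\varphi_j}}$, where $x=\eta\cosh^2r$ and $\varkappa=-\eta\sinh(2r)\frac{1-\eta}{2(1-\eta\cosh2r)}$.
   Formalization: The constant c may depend on the fixed η (it is uniform in β, s_max, σ_eff, μ_T, n, ε); a c independent of η is impossible, since for k=1, βs_max≥π/2 the needed B grows like (1−η)^(-2) as η→1. The shot budget B is a positive real, not an integer. *)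

theory Defs
  imports "HOL-Probability.Probability" "HOL-Library.Poly_Mapping"
begin

text \<open>Sequences indexed by the nonpositive integers are functions on \<^typ>\<open>nat\<close>: the argument is
  the lag \<open>l = -t\<close>, so the time step preceding \<open>l\<close> is \<open>Suc l\<close>.\<close>

definition inputs :: "real \<Rightarrow> (nat \<Rightarrow> real) set" where
  "inputs smax = {s. \<forall>l. \<bar>s l\<bar> \<le> smax}"

definition rho_bar :: "real \<Rightarrow> real \<Rightarrow> real" where
  "rho_bar \<eta> r = \<eta> * exp (2 * r)"

text \<open>The guard does not constrain the mask, which may be any sequence of real phases.\<close>

definition guard_compatible :: "real \<Rightarrow> (nat \<Rightarrow> real) \<Rightarrow> real \<Rightarrow> bool" where
  "guard_compatible \<eta> \<phi> r \<longleftrightarrow> 0 < r \<and> rho_bar \<eta> r < 1"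

definition v_inf :: "real \<Rightarrow> real \<Rightarrow> real" where
  "v_inf \<eta> r = (1 - \<eta>) / (2 * (1 - rho_bar \<eta> r))"

definition transfer :: "real \<Rightarrow> real \<Rightarrow> real \<Rightarrow> complex ^ 3 ^ 3" where
  "transfer \<eta> r \<theta> = \<eta> *\<^sub>R vector
     [vector [of_real ((cosh r)\<^sup>2), exp (2 * \<i> * of_real \<theta>) * of_real ((sinh r)\<^sup>2),
              - exp (\<i> * of_real \<theta>) * of_real (sinh (2 * r))],
      vector [exp (- 2 * \<i> * of_real \<theta>) * of_real ((sinh r)\<^sup>2), of_real ((cosh r)\<^sup>2),
              - exp (- \<i> * of_real \<theta>) * of_real (sinh (2 * r))],
      vector [- (1 / 2) * exp (- \<i> * of_real \<theta>) * of_real (sinh (2 * r)),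
              - (1 / 2) * exp (\<i> * of_real \<theta>) * of_real (sinh (2 * r)),
              of_real (cosh (2 * r))]]"

definition vacuum_drive :: "real \<Rightarrow> complex ^ 3" where
  "vacuum_drive \<eta> = vector [0, 0, of_real ((1 - \<eta>) / 2)]"

definition moments ::
  "real \<Rightarrow> real \<Rightarrow> real \<Rightarrow> (nat \<Rightarrow> real) \<Rightarrow> (nat \<Rightarrow> real) \<Rightarrow> nat \<Rightarrow> complex ^ 3" where
  "moments \<eta> \<beta> r \<phi> s = (THE v. bounded (range v) \<and>
     (\<forall>l. v l = transfer \<eta> r (\<phi> l + \<beta> * s l) *v v (Suc l) + vacuum_drive \<eta>))"

definition anomalous_moment ::
  "real \<Rightarrow> real \<Rightarrow> real \<Rightarrow> (nat \<Rightarrow> real) \<Rightarrow> (nat \<Rightarrow> real) \<Rightarrow> nat \<Rightarrow> complex" where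
  "anomalous_moment \<eta> \<beta> r \<phi> s l = moments \<eta> \<beta> r \<phi> s l $ 1"

text \<open>A pattern is an \<open>n :: nat \<Rightarrow> int\<close> with finite support; the sum and the product below
  degenerate without that finiteness.\<close>

definition weight :: "(nat \<Rightarrow> int) \<Rightarrow> nat" where
  "weight n = (\<Sum>l | n l \<noteq> 0. nat \<bar>n l\<bar>)"

definition pattern_exp :: "real \<Rightarrow> (nat \<Rightarrow> int) \<Rightarrow> (nat \<Rightarrow> real) \<Rightarrow> complex" where
  "pattern_exp \<beta> n s = (\<Prod>l | n l \<noteq> 0. exp (\<i> * of_real (\<beta> * of_int (n l) * s l)))"

text \<open>Circularly symmetric centered Gaussian with second absolute moment \<open>v > 0\<close>: real and
  imaginary part are independent, each with variance \<open>v / 2\<close> (\<^const>\<open>normal_density\<close> takes the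
  standard deviation).\<close>

definition complex_gaussian :: "real \<Rightarrow> complex measure" where
  "complex_gaussian v =
     distr (density lborel (normal_density 0 (sqrt (v / 2))) \<Otimes>\<^sub>M
            density lborel (normal_density 0 (sqrt (v / 2))))
       borel (\<lambda>(a, b). Complex a b)"

text \<open>Joint law of the readout noise: a sample is the whole sequence \<open>\<zeta>\<close>, and its coordinates are
  independent.\<close>

definition readout_noise :: "real \<Rightarrow> real \<Rightarrow> real \<Rightarrow> (nat \<Rightarrow> complex) measure" where
  "readout_noise \<sigma> \<mu> B = Pi\<^sub>M UNIV (\<lambda>_. complex_gaussian (\<sigma>\<^sup>2 / (\<mu>\<^sup>2 * B)))"

definition fir_coeff :: "real \<Rightarrow> real \<Rightarrow> real" where
  "fir_coeff \<eta> r = \<eta> * (cosh r)\<^sup>2"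

definition fir_gain :: "real \<Rightarrow> real \<Rightarrow> real" where
  "fir_gain \<eta> r = - \<eta> * sinh (2 * r) * ((1 - \<eta>) / (2 * (1 - \<eta> * cosh (2 * r))))"

definition measured_moment ::
  "real \<Rightarrow> real \<Rightarrow> real \<Rightarrow> (nat \<Rightarrow> real) \<Rightarrow> (nat \<Rightarrow> real) \<Rightarrow> (nat \<Rightarrow> complex) \<Rightarrow> nat \<Rightarrow> complex" where
  "measured_moment \<eta> \<beta> r \<phi> s \<zeta> l = anomalous_moment \<eta> \<beta> r \<phi> s l + \<zeta> l"

definition measured_feature ::
  "real \<Rightarrow> real \<Rightarrow> real \<Rightarrow> (nat \<Rightarrow> real) \<Rightarrow> (nat \<Rightarrow> real) \<Rightarrow> (nat \<Rightarrow> complex) \<Rightarrow> nat \<Rightarrow> complex" where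
  "measured_feature \<eta> \<beta> r \<phi> s \<zeta> l =
     (measured_moment \<eta> \<beta> r \<phi> s \<zeta> l
        - of_real (fir_coeff \<eta> r) * measured_moment \<eta> \<beta> r \<phi> s \<zeta> (Suc l))
     / (of_real (fir_gain \<eta> r) * exp (\<i> * of_real (\<phi> l)))"

text \<open>Formal multivariate polynomials: a monomial is a finitely supported exponent vector, a
  polynomial a finitely supported family of coefficients.\<close>

type_synonym 'x cpoly = "('x \<Rightarrow>\<^sub>0 nat) \<Rightarrow>\<^sub>0 complex"

definition monom_degree :: "('x \<Rightarrow>\<^sub>0 nat) \<Rightarrow> nat" where
  "monom_degree a = (\<Sum>x\<in>Poly_Mapping.keys a. Poly_Mapping.lookup a x)"

definition total_degree :: "'x cpoly \<Rightarrow> nat" where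
  "total_degree p = Max (insert 0 (monom_degree ` Poly_Mapping.keys p))"

definition cpoly_eval :: "'x cpoly \<Rightarrow> ('x \<Rightarrow> complex) \<Rightarrow> complex" where
  "cpoly_eval p z = (\<Sum>a\<in>Poly_Mapping.keys p. Poly_Mapping.lookup p a *
     (\<Prod>x\<in>Poly_Mapping.keys a. z x ^ Poly_Mapping.lookup a x))"

text \<open>The variable \<open>Inl l\<close> stands for the feature at lag \<open>l\<close>, \<open>Inr l\<close> for its conjugate.\<close>

definition estimate :: "(nat + nat) cpoly \<Rightarrow> (nat \<Rightarrow> complex) \<Rightarrow> complex" where
  "estimate p g = cpoly_eval p (case_sum g (\<lambda>l. cnj (g l)))"

end

theory Submission
  imports Defs
begin

text \<open>For weak squeezing \<open>r\<close> the anomalous moments are \<open>O(r)\<close>, hence the occupation \<open>J\<close> is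
  stationary up to \<open>O(r\<^sup>2)\<close> and a noiseless feature equals \<open>e\<^bsup>i \<beta> s\<^esup>\<close> up to
  \<open>O(r\<^sup>2)\<close>. The estimator is the monomial of features and conjugate features prescribed by the
  pattern. Its bias is \<open>O(k r\<^sup>2)\<close>, so \<open>r\<close> is taken of order \<open>sqrt (\<epsilon> / k)\<close>. The deconvolution
  gain is of order \<open>r\<close>, so the noise contributes \<open>O(k \<sigma> / (\<mu> r sqrt B))\<close>, which is at most
  \<open>\<epsilon>\<close> once \<open>B\<close> is of order \<open>(\<sigma> / \<mu>)\<^sup>2 k\<^sup>3 / \<epsilon>\<^sup>3\<close>.\<close>

section \<open>Bounded solutions of the moment recursion\<close>

text \<open>The recursion runs into the past and has no initial value; boundedness takes its place.
  Subtracting the fixed point \<open>c / (1 - q)\<close> leaves a contraction, and \<open>N\<close>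
  iterations bound the excess by \<open>q ^ N * (M - A)\<close>, which tends to zero.\<close>

lemma bounded_recursion_le:
  fixes a :: "nat \<Rightarrow> real"
  assumes "0 \<le> q" "q < 1" and step: "\<And>l. a l \<le> q * a (Suc l) + c" and bound: "\<And>l. a l \<le> M"
  shows "a l \<le> c / (1 - q)"
proof -
  define A where "A = c / (1 - q)"
  have A: "A = q * A + c"
    using assms(2) by (simp add: A_def field_simps)
  have shift: "a l - A \<le> q * (a (Suc l) - A)" for l
    using step[of l] A by (simp add: algebra_simps)
  have iter: "a l - A \<le> q ^ N * (M - A)" for N l
  proof (induction N arbitrary: l)
    case 0
    show ?case using bound[of l] by simp
  next
    case (Suc N)
    have "a l - A \<le> q * (a (Suc l) - A)" by (rule shift)
    also have "\<dots> \<le> q * (q ^ N * (M - A))"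
      using Suc[of "Suc l"] assms(1) by (rule mult_left_mono)
    finally show ?case by (simp add: mult_ac)
  qed
  have "(\<lambda>N. q ^ N * (M - A)) \<longlonglongrightarrow> 0 * (M - A)"
    using assms by (intro tendsto_mult tendsto_const LIMSEQ_realpow_zero)
  then have "a l - A \<le> 0"
    using iter by (intro LIMSEQ_le_const[where x = "0::real"]) auto
  then show ?thesis by (simp add: A_def)
qed

section \<open>Maximum norm on the moment vectors and contraction by the transfer matrices\<close>

definition sup_norm :: "complex ^ 3 \<Rightarrow> real" where
  "sup_norm v = max (cmod (v $ 1)) (max (cmod (v $ 2)) (cmod (v $ 3)))"

lemma cmod_nth_le_sup_norm:
  "cmod (v $ 1) \<le> sup_norm v" "cmod (v $ 2) \<le> sup_norm v" "cmod (v $ 3) \<le> sup_norm v"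
  by (auto simp: sup_norm_def)

lemma sup_norm_le_norm: "sup_norm v \<le> norm v"
  by (auto simp: sup_norm_def Finite_Cartesian_Product.norm_nth_le)

lemma norm_le_sup_norm: "norm v \<le> 3 * sup_norm v"
proof -
  have "norm v \<le> (\<Sum>i\<in>UNIV. cmod (v $ i))"
    unfolding norm_vec_def by (rule L2_set_le_sum) simp
  also have "\<dots> = cmod (v $ 1) + cmod (v $ 2) + cmod (v $ 3)"
    by (simp add: sum_3)
  finally show ?thesis using cmod_nth_le_sup_norm[of v] by linarith
qed

lemma sup_norm_triangle: "sup_norm (v + w) \<le> sup_norm v + sup_norm w"
  using cmod_nth_le_sup_norm[of v] cmod_nth_le_sup_norm[of w]
    norm_triangle_ineq[of "v $ 1" "w $ 1"] norm_triangle_ineq[of "v $ 2" "w $ 2"]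
    norm_triangle_ineq[of "v $ 3" "w $ 3"]
  by (simp add: sup_norm_def[of "v + w"])

lemma transfer_mult_nth:
  "(transfer \<eta> r \<theta> *v v) $ 1 = of_real \<eta> * (of_real ((cosh r)\<^sup>2) * v $ 1
     + exp (2 * \<i> * of_real \<theta>) * of_real ((sinh r)\<^sup>2) * v $ 2
     - exp (\<i> * of_real \<theta>) * of_real (sinh (2 * r)) * v $ 3)"
  "(transfer \<eta> r \<theta> *v v) $ 2 = of_real \<eta> * (exp (- 2 * \<i> * of_real \<theta>) * of_real ((sinh r)\<^sup>2) * v $ 1
     + of_real ((cosh r)\<^sup>2) * v $ 2
     - exp (- \<i> * of_real \<theta>) * of_real (sinh (2 * r)) * v $ 3)"
  "(transfer \<eta> r \<theta> *v v) $ 3 = of_real \<eta> * (of_real (cosh (2 * r)) * v $ 3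
     - (1 / 2) * of_real (sinh (2 * r)) *
       (exp (- \<i> * of_real \<theta>) * v $ 1 + exp (\<i> * of_real \<theta>) * v $ 2))"
  unfolding transfer_def matrix_vector_mult_def
  by (simp_all add: sum_3 scaleR_conv_of_real[where 'a = complex] algebra_simps)

lemma vacuum_drive_nth:
  "vacuum_drive \<eta> $ 1 = 0" "vacuum_drive \<eta> $ 2 = 0"
  "vacuum_drive \<eta> $ 3 = of_real ((1 - \<eta>) / 2)"
  by (simp_all add: vacuum_drive_def)

lemma cmod_exp_phase:
  "cmod (exp (\<i> * of_real \<theta>)) = 1" "cmod (exp (- \<i> * of_real \<theta>)) = 1"
  "cmod (exp (2 * \<i> * of_real \<theta>)) = 1" "cmod (exp (- 2 * \<i> * of_real \<theta>)) = 1"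
  by (simp_all add: norm_exp_eq_Re)

lemma cosh_sq_plus_sinh_sq: "(cosh r)\<^sup>2 + (sinh r)\<^sup>2 = cosh (2 * r)" for r :: real
  by (simp add: cosh_double cosh_add)

lemma cosh_plus_sinh_double: "cosh (2 * r) + sinh (2 * r) = exp (2 * r)" for r :: real
  by (simp add: cosh_def sinh_def field_simps)

text \<open>The bounds \<open>M\<close> on the anomalous moments and \<open>J\<close> on the
  occupation are kept apart, so that the coupling between the two blocks visibly carries
  \<open>sinh (2 * r)\<close>. This separation yields the orders in \<open>r\<close> of the later
  estimates.\<close>

lemma cmod_transfer_mult_le:
  assumes "0 \<le> \<eta>" "0 \<le> r" and "cmod (v $ 1) \<le> M" "cmod (v $ 2) \<le> M" "cmod (v $ 3) \<le> J"
  shows "cmod ((transfer \<eta> r \<theta> *v v) $ 1) \<le> \<eta> * cosh (2 * r) * M + \<eta> * sinh (2 * r) * J"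
    and "cmod ((transfer \<eta> r \<theta> *v v) $ 2) \<le> \<eta> * cosh (2 * r) * M + \<eta> * sinh (2 * r) * J"
    and "cmod ((transfer \<eta> r \<theta> *v v) $ 3) \<le> \<eta> * cosh (2 * r) * J + \<eta> * sinh (2 * r) * M"
proof -
  have s: "0 \<le> sinh (2 * r)" "0 \<le> cosh (2 * r)" using assms by auto
  \<comment> \<open>Shared by the first two rows, where \<open>C\<close> and \<open>D\<close> are
    \<open>(cosh r)^2\<close> and \<open>(sinh r)^2\<close> in either order.\<close>
  have row: "cmod (of_real \<eta> * (p + q - w)) \<le> \<eta> * cosh (2 * r) * M + \<eta> * sinh (2 * r) * J"
    if "cmod p \<le> C * M" "cmod q \<le> D * M" "cmod w \<le> sinh (2 * r) * J" "C + D = cosh (2 * r)"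
    for p q w C D
  proof -
    have "cmod (p + q - w) \<le> cmod p + cmod q + cmod w"
      using norm_triangle_ineq4[of "p + q" w] norm_triangle_ineq[of p q] by linarith
    also have "\<dots> \<le> (C + D) * M + sinh (2 * r) * J"
      using that(1-3) unfolding distrib_right by linarith
    finally have "\<eta> * cmod (p + q - w) \<le> \<eta> * (cosh (2 * r) * M + sinh (2 * r) * J)"
      using that assms by (intro mult_left_mono) auto
    then show ?thesis unfolding norm_mult using assms by (simp add: algebra_simps)
  qed
  show "cmod ((transfer \<eta> r \<theta> *v v) $ 1) \<le> \<eta> * cosh (2 * r) * M + \<eta> * sinh (2 * r) * J"
    unfolding transfer_mult_nth
    by (rule row[of _ "(cosh r)\<^sup>2" _ "(sinh r)\<^sup>2"])
      (use assms s in \<open>simp_all add: norm_mult cmod_exp_phase mult_left_mono cosh_sq_plus_sinh_sq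
         del: of_real_power\<close>)
  show "cmod ((transfer \<eta> r \<theta> *v v) $ 2) \<le> \<eta> * cosh (2 * r) * M + \<eta> * sinh (2 * r) * J"
    unfolding transfer_mult_nth
    by (rule row[of _ "(sinh r)\<^sup>2" _ "(cosh r)\<^sup>2"])
      (use assms s in \<open>simp_all add: norm_mult cmod_exp_phase[simplified] cmod_exp_phase mult_left_mono
         cosh_sq_plus_sinh_sq add.commute[of "(sinh r)\<^sup>2"] del: of_real_power\<close>)
  have "cmod (exp (- \<i> * of_real \<theta>) * v $ 1 + exp (\<i> * of_real \<theta>) * v $ 2) \<le> 2 * M"
    by (rule order_trans[OF norm_triangle_ineq])
      (use assms in \<open>simp add: norm_mult cmod_exp_phase[simplified]\<close>)
  then have "cmod ((1 / 2) * of_real (sinh (2 * r)) *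
       (exp (- \<i> * of_real \<theta>) * v $ 1 + exp (\<i> * of_real \<theta>) * v $ 2)) \<le> 1/2 * sinh (2 * r) * (2 * M)"
    unfolding norm_mult using s by (intro mult_mono) auto
  moreover have "cmod (of_real (cosh (2 * r)) * v $ 3) \<le> cosh (2 * r) * J"
    using assms s by (simp add: norm_mult mult_left_mono)
  ultimately have "cmod (of_real (cosh (2 * r)) * v $ 3
     - (1 / 2) * of_real (sinh (2 * r)) *
       (exp (- \<i> * of_real \<theta>) * v $ 1 + exp (\<i> * of_real \<theta>) * v $ 2))
      \<le> cosh (2 * r) * J + sinh (2 * r) * M"
    by (intro order_trans[OF norm_triangle_ineq4] add_mono) simp_all
  then show "cmod ((transfer \<eta> r \<theta> *v v) $ 3) \<le> \<eta> * cosh (2 * r) * J + \<eta> * sinh (2 * r) * M"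
    unfolding transfer_mult_nth norm_mult[of "of_real \<eta>"]
    using assms by (simp add: mult_left_mono mult.assoc flip: distrib_left)
qed

text \<open>Every row of the transfer matrix has absolute row sum exactly
  \<open>\<eta> * (cosh (2 * r) + sinh (2 * r))\<close>, that is \<open>rho_bar\<close>. The guard
  therefore makes each step a strict contraction in the maximum norm, whatever the phase.\<close>

lemma sup_norm_transfer_mult_le:
  assumes "0 \<le> \<eta>" "0 \<le> r"
  shows "sup_norm (transfer \<eta> r \<theta> *v v) \<le> rho_bar \<eta> r * sup_norm v"
proof -
  have "\<eta> * cosh (2 * r) * m + \<eta> * sinh (2 * r) * m = rho_bar \<eta> r * m" for m
    unfolding rho_bar_def cosh_plus_sinh_double[symmetric] by (simp add: algebra_simps)
  then show ?thesis
    using cmod_transfer_mult_le[OF assms cmod_nth_le_sup_norm, of \<theta> v]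
    by (simp add: sup_norm_def[of "_ *v _"])
qed

text \<open>The drive cancels in the difference of two solutions, so the scalar recursion applies
  with \<open>c = 0\<close>.\<close>

lemma bounded_solution_unique:
  assumes "0 \<le> \<eta>" "0 \<le> r" "rho_bar \<eta> r < 1"
    and "bounded (range v)" "\<And>l. v l = transfer \<eta> r (\<theta> l) *v v (Suc l) + b"
    and "bounded (range w)" "\<And>l. w l = transfer \<eta> r (\<theta> l) *v w (Suc l) + b"
  shows "v = w"
proof -
  obtain C D where CD: "\<And>l. norm (v l) \<le> C" "\<And>l. norm (w l) \<le> D"
    using assms(4,6) by (auto simp: bounded_iff)
  have "sup_norm (v l - w l) \<le> 0 / (1 - rho_bar \<eta> r)" for l
  proof (rule bounded_recursion_le)
    fix l
    have "v l - w l = transfer \<eta> r (\<theta> l) *v (v (Suc l) - w (Suc l))"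
      by (subst assms(5), subst assms(7)) (simp add: matrix_vector_mult_diff_distrib)
    then show "sup_norm (v l - w l) \<le> rho_bar \<eta> r * sup_norm (v (Suc l) - w (Suc l)) + 0"
      using sup_norm_transfer_mult_le[OF assms(1,2)] by simp
    show "sup_norm (v l - w l) \<le> C + D"
      using sup_norm_le_norm[of "v l - w l"] norm_triangle_ineq4[of "v l" "w l"] CD[of l] by linarith
  qed (use assms(1-3) in \<open>auto simp: rho_bar_def\<close>)
  then have "norm (v l - w l) \<le> 0" for l
    using norm_le_sup_norm[of "v l - w l"] unfolding div_0 by (smt (verit))
  then show ?thesis by (simp add: fun_eq_iff)
qed

text \<open>The solution is a Neumann series: the sum of all past drives transported to the present
  lag, with a geometric majorant of ratio \<open>rho_bar\<close>.\<close>

lemma bounded_solution_exists: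
  assumes "0 \<le> \<eta>" "0 \<le> r" "rho_bar \<eta> r < 1"
  shows "\<exists>v. bounded (range v) \<and> (\<forall>l. v l = transfer \<eta> r (\<theta> l) *v v (Suc l) + b)"
proof -
  let ?T = "\<lambda>l. transfer \<eta> r (\<theta> l)" and ?\<rho> = "rho_bar \<eta> r"
  \<comment> \<open>\<open>D N l\<close> is the drive injected at lag \<open>l + N\<close> and
    carried to lag \<open>l\<close> by \<open>N\<close> transfer matrices. The recursion builds
    functions of the lag because the lag moves at each step.\<close>
  define D where "D = rec_nat (\<lambda>l. b) (\<lambda>N d l. ?T l *v d (Suc l))"
  have D_0: "D 0 l = b" and D_Suc: "D (Suc N) l = ?T l *v D N (Suc l)" for N l
    by (simp_all add: D_def)
  have \<rho>: "0 \<le> ?\<rho>" using assms by (simp add: rho_bar_def)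
  have "sup_norm (D N l) \<le> ?\<rho> ^ N * sup_norm b" for N l
  proof (induction N arbitrary: l)
    case (Suc N)
    have "sup_norm (D (Suc N) l) \<le> ?\<rho> * sup_norm (D N (Suc l))"
      unfolding D_Suc using assms by (intro sup_norm_transfer_mult_le)
    also have "\<dots> \<le> ?\<rho> * (?\<rho> ^ N * sup_norm b)"
      using Suc \<rho> by (intro mult_left_mono)
    finally show ?case by (simp add: mult.assoc)
  qed (simp add: D_0)
  then have D_le: "norm (D N l) \<le> ?\<rho> ^ N * (3 * sup_norm b)" for N l
    using norm_le_sup_norm[of "D N l"]
    by (metis (no_types) mult.left_commute mult_left_mono order_trans zero_le_numeral)
  have geom: "summable (\<lambda>N. ?\<rho> ^ N * (3 * sup_norm b))"
    using \<rho> assms by (intro summable_mult2 summable_geometric) auto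
  have D_summable: "summable (\<lambda>N. D N l)" for l
    using geom D_le by (rule summable_comparison_test')
  define v where "v l = suminf (\<lambda>N. D N l)" for l
  have "norm (v l) \<le> suminf (\<lambda>N. ?\<rho> ^ N * (3 * sup_norm b))" for l
    unfolding v_def using D_le geom by (rule norm_suminf_le)
  then have "bounded (range v)" by (auto simp: bounded_iff)
  moreover have "v l = ?T l *v v (Suc l) + b" for l
  proof -
    have "bounded_linear ((*v) (?T l))"
      by (rule matrix_vector_mul_bounded_linear)
    then have "?T l *v v (Suc l) = suminf (\<lambda>N. ?T l *v D N (Suc l))"
      unfolding v_def using D_summable by (rule bounded_linear.suminf)
    also have "\<dots> = suminf (\<lambda>N. D (Suc N) l)" by (simp add: D_Suc)
    also have "\<dots> = v l - b"
      unfolding v_def using suminf_split_head[OF D_summable] by (simp add: D_0)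
    finally show ?thesis by simp
  qed
  ultimately show ?thesis by blast
qed

text \<open>Existence and uniqueness turn the definite description in \<open>moments\<close> into
  usable properties.\<close>

lemma
  assumes "0 \<le> \<eta>" "0 \<le> r" "rho_bar \<eta> r < 1"
  shows bounded_moments: "bounded (range (moments \<eta> \<beta> r \<phi> s))" (is ?B)
    and moments_recursion: "moments \<eta> \<beta> r \<phi> s l =
      transfer \<eta> r (\<phi> l + \<beta> * s l) *v moments \<eta> \<beta> r \<phi> s (Suc l) + vacuum_drive \<eta>" (is ?R)
proof -
  let ?P = "\<lambda>v. bounded (range v) \<and>
     (\<forall>l. v l = transfer \<eta> r (\<phi> l + \<beta> * s l) *v v (Suc l) + vacuum_drive \<eta>)"
  have "\<exists>!v. ?P v"
    by (rule ex_ex1I[OF bounded_solution_exists[OF assms]])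
      (rule bounded_solution_unique[OF assms], blast+)
  from theI'[OF this] show ?B ?R
    unfolding moments_def by blast+
qed

section \<open>Bias of a deconvolved feature\<close>

text \<open>The fixed point of the third moment when the anomalous moments vanish.\<close>

definition J_stat :: "real \<Rightarrow> real \<Rightarrow> real" where
  "J_stat \<eta> r = (1 - \<eta>) / (2 * (1 - \<eta> * cosh (2 * r)))"

context
  fixes \<eta> r :: real
  assumes \<eta>: "0 < \<eta>" "\<eta> < 1" and r: "0 < r" and guard: "rho_bar \<eta> r < 1"
begin

lemma eta_cosh_le_rho: "\<eta> * cosh (2 * r) \<le> rho_bar \<eta> r"
  unfolding rho_bar_def cosh_plus_sinh_double[symmetric] using \<eta> r by (simp add: distrib_left)

lemma J_stat_pos: "0 < J_stat \<eta> r"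
  using \<eta> eta_cosh_le_rho guard by (simp add: J_stat_def)

lemma J_stat_fixed: "J_stat \<eta> r = \<eta> * cosh (2 * r) * J_stat \<eta> r + (1 - \<eta>) / 2"
  using eta_cosh_le_rho guard by (simp add: J_stat_def field_simps)

text \<open>This is the coefficient of the input phase in the first row when the occupation sits at
  \<open>J_stat\<close>; dividing by it normalises the feature.\<close>

lemma fir_gain_eq: "fir_gain \<eta> r = - (\<eta> * sinh (2 * r) * J_stat \<eta> r)"
  by (simp add: fir_gain_def J_stat_def)

context
  fixes \<beta> :: real and \<phi> s :: "nat \<Rightarrow> real" and v
  assumes v_def: "v = moments \<eta> \<beta> r \<phi> s"
begin

lemma moments_bounded: "\<exists>C. \<forall>l. sup_norm (v l) \<le> C"
proof -
  have "bounded (range v)"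
    unfolding v_def using \<eta> r guard by (intro bounded_moments) auto
  then obtain C where "\<And>l. norm (v l) \<le> C" by (auto simp: bounded_iff)
  then show ?thesis using sup_norm_le_norm order_trans by blast
qed

lemma moments_step: "v l = transfer \<eta> r (\<phi> l + \<beta> * s l) *v v (Suc l) + vacuum_drive \<eta>"
  unfolding v_def using \<eta> r guard by (intro moments_recursion) auto

text \<open>\<open>v_inf\<close> is the fixed point of the scalar recursion with rate
  \<open>rho_bar\<close> and drive \<open>(1 - \<eta>) / 2\<close>.\<close>

lemma sup_norm_moments_le: "sup_norm (v l) \<le> v_inf \<eta> r"
proof -
  obtain C where C: "\<And>l. sup_norm (v l) \<le> C" using moments_bounded by blast
  have "sup_norm (v l) \<le> ((1 - \<eta>) / 2) / (1 - rho_bar \<eta> r)"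
  proof (rule bounded_recursion_le)
    fix l
    have "sup_norm (v l) \<le> sup_norm (transfer \<eta> r (\<phi> l + \<beta> * s l) *v v (Suc l)) + sup_norm (vacuum_drive \<eta>)"
      by (subst moments_step) (rule sup_norm_triangle)
    moreover have "sup_norm (vacuum_drive \<eta>) = (1 - \<eta>) / 2"
      using \<eta> by (simp add: sup_norm_def vacuum_drive_nth del: of_real_divide)
    ultimately show "sup_norm (v l) \<le> rho_bar \<eta> r * sup_norm (v (Suc l)) + (1 - \<eta>) / 2"
      using sup_norm_transfer_mult_le[of \<eta> r "\<phi> l + \<beta> * s l" "v (Suc l)"] \<eta> r by linarith
  qed (use \<eta> guard C in \<open>auto simp: rho_bar_def\<close>)
  then show ?thesis by (simp add: v_inf_def)
qed

text \<open>The vacuum drive has no anomalous component, so the only source is the occupation,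
  entering through \<open>sinh (2 * r)\<close>. The anomalous moments are thus of first order in
  \<open>r\<close>. The maximum of both is taken because their rows are coupled.\<close>

lemma anomalous_le:
  "max (cmod (v l $ 1)) (cmod (v l $ 2)) \<le> \<eta> * sinh (2 * r) * v_inf \<eta> r / (1 - \<eta> * cosh (2 * r))"
proof -
  obtain C where C: "\<And>l. sup_norm (v l) \<le> C" using moments_bounded by blast
  show ?thesis
  proof (rule bounded_recursion_le)
    fix l
    let ?M = "max (cmod (v (Suc l) $ 1)) (cmod (v (Suc l) $ 2))"
    have J: "cmod (v (Suc l) $ 3) \<le> v_inf \<eta> r"
      using sup_norm_moments_le[of "Suc l"] cmod_nth_le_sup_norm(3)[of "v (Suc l)"] by linarith
    have "v l $ 1 = (transfer \<eta> r (\<phi> l + \<beta> * s l) *v v (Suc l)) $ 1"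
      "v l $ 2 = (transfer \<eta> r (\<phi> l + \<beta> * s l) *v v (Suc l)) $ 2"
      by (subst moments_step, simp add: vacuum_drive_nth)+
    then show "max (cmod (v l $ 1)) (cmod (v l $ 2)) \<le> \<eta> * cosh (2 * r) * ?M + \<eta> * sinh (2 * r) * v_inf \<eta> r"
      using cmod_transfer_mult_le(1,2)[of \<eta> r "v (Suc l)" ?M "v_inf \<eta> r" "\<phi> l + \<beta> * s l"] \<eta> r J by simp
  next
    fix l
    show "max (cmod (v l $ 1)) (cmod (v l $ 2)) \<le> C"
      using C[of l] by (simp add: sup_norm_def)
  qed (use \<eta> guard eta_cosh_le_rho in auto)
qed

text \<open>Subtracting \<open>J_stat\<close> removes the drive and leaves the anomalous moments as
  source, again multiplied by \<open>sinh (2 * r)\<close>. With \<open>M\<close> of first order, the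
  deviation is of second order.\<close>

lemma J_deviation_le:
  assumes "\<And>l. max (cmod (v l $ 1)) (cmod (v l $ 2)) \<le> M"
  shows "cmod (v l $ 3 - of_real (J_stat \<eta> r)) \<le> \<eta> * sinh (2 * r) * M / (1 - \<eta> * cosh (2 * r))"
proof -
  obtain C where C: "\<And>l. sup_norm (v l) \<le> C" using moments_bounded by blast
  show ?thesis
  proof (rule bounded_recursion_le)
    fix l
    let ?\<theta> = "\<phi> l + \<beta> * s l" and ?J = "complex_of_real (J_stat \<eta> r)"
    let ?R = "exp (- \<i> * of_real ?\<theta>) * v (Suc l) $ 1 + exp (\<i> * of_real ?\<theta>) * v (Suc l) $ 2"
    have "?J = of_real (\<eta> * cosh (2 * r)) * ?J + of_real ((1 - \<eta>) / 2)"
      by (subst J_stat_fixed) (simp only: of_real_add of_real_mult)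
    moreover have "v l $ 3 = (transfer \<eta> r ?\<theta> *v v (Suc l)) $ 3 + vacuum_drive \<eta> $ 3"
      by (subst moments_step) simp
    ultimately have "v l $ 3 - ?J = (transfer \<eta> r ?\<theta> *v v (Suc l)) $ 3 - of_real (\<eta> * cosh (2 * r)) * ?J"
      unfolding vacuum_drive_nth by (metis add_diff_cancel_right)
    then have "v l $ 3 - ?J = of_real (\<eta> * cosh (2 * r)) * (v (Suc l) $ 3 - ?J)
        - of_real (\<eta> * sinh (2 * r) / 2) * ?R"
      unfolding transfer_mult_nth by (simp add: algebra_simps)
    then have "cmod (v l $ 3 - ?J) \<le> cmod (of_real (\<eta> * cosh (2 * r)) * (v (Suc l) $ 3 - ?J))
        + cmod (of_real (\<eta> * sinh (2 * r) / 2) * ?R)"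
      by (simp only: norm_triangle_ineq4)
    also have "\<dots> = \<eta> * cosh (2 * r) * cmod (v (Suc l) $ 3 - ?J) + \<eta> * sinh (2 * r) / 2 * cmod ?R"
      unfolding norm_mult norm_of_real using \<eta> r by simp
    also have "cmod ?R \<le> 2 * M"
      by (rule order_trans[OF norm_triangle_ineq])
        (use assms[of "Suc l"] in \<open>simp add: norm_mult cmod_exp_phase[simplified]\<close>)
    finally show "cmod (v l $ 3 - ?J) \<le> \<eta> * cosh (2 * r) * cmod (v (Suc l) $ 3 - ?J) + \<eta> * sinh (2 * r) * M"
      using \<eta> r by (simp add: mult_left_mono)
  next
    fix l
    show "cmod (v l $ 3 - of_real (J_stat \<eta> r)) \<le> C + J_stat \<eta> r"
      using C[of l] cmod_nth_le_sup_norm(3)[of "v l"]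
        norm_triangle_ineq4[of "v l $ 3" "of_real (J_stat \<eta> r)"] J_stat_pos by simp
  qed (use \<eta> guard eta_cosh_le_rho in auto)
qed

text \<open>The FIR subtraction cancels exactly the \<open>(cosh r)^2\<close> term of the first row.
  Two errors remain relative to the ideal phase: the deviation of the occupation from
  \<open>J_stat\<close>, and the conjugate moment weighted by
  \<open>(sinh r)^2 / sinh (2 * r)\<close>. Both are of second order in \<open>r\<close>.\<close>

lemma noiseless_feature_error:
  "cmod ((v l $ 1 - of_real (fir_coeff \<eta> r) * v (Suc l) $ 1)
      / (of_real (fir_gain \<eta> r) * exp (\<i> * of_real (\<phi> l))) - exp (\<i> * of_real (\<beta> * s l)))
    \<le> 2 * (sinh (2 * r))\<^sup>2 / (1 - rho_bar \<eta> r)\<^sup>2"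
proof -
  define S d \<rho> where "S = sinh (2 * r)" and "d = 1 - \<eta> * cosh (2 * r)" and "\<rho> = rho_bar \<eta> r"
  define M where "M = \<eta> * S * v_inf \<eta> r / d"
  let ?J = "J_stat \<eta> r" and ?\<theta> = "\<phi> l + \<beta> * s l"
  have pos: "0 < S" "0 < d" "0 < 1 - \<rho>" "1 - \<rho> \<le> d" "0 < ?J"
    using r eta_cosh_le_rho guard J_stat_pos by (auto simp: S_def d_def \<rho>_def)
  have M: "\<And>l. max (cmod (v l $ 1)) (cmod (v l $ 2)) \<le> M"
    unfolding M_def S_def d_def by (rule anomalous_le)
  \<comment> \<open>Both \<open>d * ?J\<close> and \<open>v_inf \<eta> r * (1 - \<rho>)\<close>
    equal \<open>(1 - \<eta>) / 2\<close>, so the occupation bound drops out of the relative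
    error.\<close>
  have M_J: "M / ?J = \<eta> * S / (1 - \<rho>)"
  proof -
    have "?J = (1 - \<eta>) / (2 * d)" "v_inf \<eta> r = (1 - \<eta>) / (2 * (1 - \<rho>))"
      by (simp_all add: J_stat_def v_inf_def d_def \<rho>_def)
    then have V: "0 < v_inf \<eta> r" "d * ?J = v_inf \<eta> r * (1 - \<rho>)"
      using pos \<eta> by (simp, simp add: field_simps)
    have "M / ?J = \<eta> * S * v_inf \<eta> r / (d * ?J)" by (simp add: M_def)
    also have "\<dots> = \<eta> * S / (1 - \<rho>)" using V by simp
    finally show ?thesis .
  qed
  have phase: "exp (2 * \<i> * of_real ?\<theta>) = exp (\<i> * of_real ?\<theta>) * exp (\<i> * of_real ?\<theta>)"
    by (simp flip: exp_add add: algebra_simps)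
  have split: "exp (\<i> * of_real ?\<theta>) = exp (\<i> * of_real (\<phi> l)) * exp (\<i> * of_real (\<beta> * s l))"
    by (simp flip: exp_add add: algebra_simps)
  have gain: "complex_of_real (fir_gain \<eta> r) = - (of_real \<eta> * of_real S * of_real ?J)"
    by (simp add: fir_gain_eq S_def)
  have "v l $ 1 = (transfer \<eta> r ?\<theta> *v v (Suc l)) $ 1"
    by (subst moments_step) (simp add: vacuum_drive_nth)
  then have fir: "v l $ 1 - of_real (fir_coeff \<eta> r) * v (Suc l) $ 1 =
      of_real \<eta> * (exp (2 * \<i> * of_real ?\<theta>) * of_real ((sinh r)\<^sup>2) * v (Suc l) $ 2
        - exp (\<i> * of_real ?\<theta>) * of_real S * v (Suc l) $ 3)"
    unfolding transfer_mult_nth fir_coeff_def S_def by (simp add: algebra_simps)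
  \<comment> \<open>The mask phase in the denominator cancels that of \<open>?\<theta>\<close>, and
    the ideal phase, of modulus one, factors out.\<close>
  have "(v l $ 1 - of_real (fir_coeff \<eta> r) * v (Suc l) $ 1)
      / (of_real (fir_gain \<eta> r) * exp (\<i> * of_real (\<phi> l))) - exp (\<i> * of_real (\<beta> * s l))
    = exp (\<i> * of_real (\<beta> * s l)) * ((v (Suc l) $ 3 - of_real ?J) / of_real ?J
        - exp (\<i> * of_real ?\<theta>) * of_real ((sinh r)\<^sup>2 / S) * (v (Suc l) $ 2 / of_real ?J))"
    unfolding fir phase gain split using pos \<eta> by (simp add: field_simps)
  then have "cmod ((v l $ 1 - of_real (fir_coeff \<eta> r) * v (Suc l) $ 1)
      / (of_real (fir_gain \<eta> r) * exp (\<i> * of_real (\<phi> l))) - exp (\<i> * of_real (\<beta> * s l)))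
    = cmod ((v (Suc l) $ 3 - of_real ?J) / of_real ?J
        - exp (\<i> * of_real ?\<theta>) * of_real ((sinh r)\<^sup>2 / S) * (v (Suc l) $ 2 / of_real ?J))"
    by (simp only: norm_mult cmod_exp_phase mult_1)
  also have "\<dots> \<le> cmod ((v (Suc l) $ 3 - of_real ?J) / of_real ?J)
     + cmod (exp (\<i> * of_real ?\<theta>) * of_real ((sinh r)\<^sup>2 / S) * (v (Suc l) $ 2 / of_real ?J))"
    by (rule norm_triangle_ineq4)
  also have "\<dots> = cmod (v (Suc l) $ 3 - of_real ?J) / ?J + (sinh r)\<^sup>2 / S * (cmod (v (Suc l) $ 2) / ?J)"
    unfolding norm_mult norm_divide cmod_exp_phase norm_of_real using pos by simp
  also have "\<dots> \<le> (\<eta> * S * M / d) / ?J + S * (M / ?J)"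
  proof (intro add_mono divide_right_mono mult_mono)
    show "cmod (v (Suc l) $ 3 - of_real ?J) \<le> \<eta> * S * M / d"
      unfolding S_def d_def using M by (rule J_deviation_le)
    show "cmod (v (Suc l) $ 2) \<le> M" using M[of "Suc l"] by simp
    have "sinh r \<le> S" using r by (simp add: S_def)
    then have "(sinh r)\<^sup>2 \<le> S\<^sup>2" using r by (intro power_mono) auto
    then show "(sinh r)\<^sup>2 / S \<le> S" using pos by (simp add: field_simps power2_eq_square)
  qed (use pos in auto)
  also have "\<dots> = \<eta> * S / d * (\<eta> * S / (1 - \<rho>)) + S * (\<eta> * S / (1 - \<rho>))"
    by (simp flip: M_J)
  \<comment> \<open>Weakening with \<open>\<eta> \<le> 1\<close>, \<open>1 - \<rho> \<le> d\<close>
    and \<open>1 - \<rho> \<le> 1\<close> gives both errors the same bound, hence the factor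
    2.\<close>
  also have "\<dots> \<le> S / (1 - \<rho>) * (S / (1 - \<rho>)) + S / (1 - \<rho>) * (S / (1 - \<rho>))"
  proof -
    have e: "\<eta> * S \<le> S" using \<eta> pos by simp
    have "1 - \<rho> \<le> 1" using \<eta> by (simp add: \<rho>_def rho_bar_def)
    then have "S * (1 - \<rho>) \<le> S * 1" using pos by (intro mult_left_mono) auto
    then have "S \<le> S / (1 - \<rho>)" using pos by (simp add: field_simps)
    moreover have "\<eta> * S / d \<le> S / (1 - \<rho>)" "\<eta> * S / (1 - \<rho>) \<le> S / (1 - \<rho>)"
      using e pos by (auto intro!: frac_le)
    ultimately show ?thesis using pos \<eta> by (intro add_mono mult_mono) auto
  qed
  also have "\<dots> = 2 * S\<^sup>2 / (1 - \<rho>)\<^sup>2"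
    by (simp add: power2_eq_square)
  finally show ?thesis by (simp add: S_def \<rho>_def)
qed

end

text \<open>The feature is affine in the noise, so bias and noise add. The filter has the two taps 1
  and \<open>fir_coeff\<close>, both at most 1 in modulus, and the result is amplified by the
  inverse gain.\<close>

lemma measured_feature_error:
  "cmod (measured_feature \<eta> \<beta> r \<phi> s \<zeta> l - exp (\<i> * of_real (\<beta> * s l)))
    \<le> 2 * (sinh (2 * r))\<^sup>2 / (1 - rho_bar \<eta> r)\<^sup>2
      + 1 / \<bar>fir_gain \<eta> r\<bar> * (cmod (\<zeta> l) + cmod (\<zeta> (Suc l)))"
proof -
  let ?v = "moments \<eta> \<beta> r \<phi> s"
  let ?K = "of_real (fir_gain \<eta> r) * exp (\<i> * of_real (\<phi> l))"
  let ?x = "fir_coeff \<eta> r"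
  \<comment> \<open>Dropping \<open>(sinh r)^2\<close> from \<open>cosh (2 * r)\<close> bounds the
    second tap through the guard.\<close>
  have "0 \<le> (sinh r)\<^sup>2" by simp
  then have "?x \<le> \<eta> * cosh (2 * r)"
    unfolding fir_coeff_def cosh_sq_plus_sinh_sq[symmetric] using \<eta> by (simp add: distrib_left)
  then have x: "0 \<le> ?x" "?x \<le> 1"
    using eta_cosh_le_rho guard \<eta> by (simp add: fir_coeff_def, linarith)
  have "cmod (\<zeta> l - of_real ?x * \<zeta> (Suc l)) \<le> cmod (\<zeta> l) + ?x * cmod (\<zeta> (Suc l))"
    using norm_triangle_ineq4[of "\<zeta> l" "of_real ?x * \<zeta> (Suc l)"] x by (simp add: norm_mult)
  also have "\<dots> \<le> cmod (\<zeta> l) + cmod (\<zeta> (Suc l))"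
    using x by (simp add: mult_left_le_one_le)
  finally have noise: "cmod ((\<zeta> l - of_real ?x * \<zeta> (Suc l)) / ?K)
      \<le> 1 / \<bar>fir_gain \<eta> r\<bar> * (cmod (\<zeta> l) + cmod (\<zeta> (Suc l)))"
    unfolding norm_divide norm_mult norm_of_real cmod_exp_phase by (simp add: divide_right_mono)
  have eq: "measured_feature \<eta> \<beta> r \<phi> s \<zeta> l - exp (\<i> * of_real (\<beta> * s l))
      = ((?v l $ 1 - of_real ?x * ?v (Suc l) $ 1) / ?K - exp (\<i> * of_real (\<beta> * s l)))
        + (\<zeta> l - of_real ?x * \<zeta> (Suc l)) / ?K"
    by (simp add: measured_feature_def measured_moment_def anomalous_moment_def
        diff_divide_distrib add_divide_distrib distrib_left)
  show ?thesis
    unfolding eq by (intro order_trans[OF norm_triangle_ineq] add_mono noise noiseless_feature_error refl)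
qed

end

section \<open>Gaussian readout noise\<close>

text \<open>Completing the square turns the exponentially weighted density into a multiple of a
  shifted normal density. The absolute value is covered by adding the two signs, which costs the
  factor 2.\<close>

lemma normal_exp_abs:
  assumes "0 < s"
  shows integrable_normal_exp_abs:
      "integrable (density lborel (normal_density 0 s)) (\<lambda>x. exp (a * \<bar>x\<bar>))" (is ?I)
    and integral_normal_exp_abs_le:
      "(\<integral>x. exp (a * \<bar>x\<bar>) \<partial>density lborel (normal_density 0 s)) \<le> 2 * exp (a\<^sup>2 * s\<^sup>2 / 2)" (is ?L)
proof -
  let ?N = "density lborel (normal_density 0 s)"
  have tilt: "normal_density 0 s x * exp (c * x) = exp (c\<^sup>2 * s\<^sup>2 / 2) * normal_density (c * s\<^sup>2) s x" for c x
  proof -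
    have "- (x - 0)\<^sup>2 / (2 * s\<^sup>2) + c * x = c\<^sup>2 * s\<^sup>2 / 2 + - (x - c * s\<^sup>2)\<^sup>2 / (2 * s\<^sup>2)"
      using assms by (simp add: field_simps power2_eq_square)
    then show ?thesis
      unfolding normal_density_def by (simp flip: exp_add)
  qed
  have int: "integrable ?N (\<lambda>x. exp (c * x))" for c
    using assms by (subst integrable_density) (simp_all add: tilt)
  have val: "(\<integral>x. exp (c * x) \<partial>?N) = exp (c\<^sup>2 * s\<^sup>2 / 2)" for c
    using assms by (subst integral_density) (simp_all add: tilt)
  have le: "exp (a * \<bar>x\<bar>) \<le> exp (a * x) + exp (- a * x)" for x
    by (cases "0 \<le> x") simp_all
  have sum: "integrable ?N (\<lambda>x. exp (a * x) + exp (- a * x))"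
    using int by (intro Bochner_Integration.integrable_add)
  show I: ?I
    by (rule Bochner_Integration.integrable_bound[OF sum]) (use le in \<open>auto intro: AE_I2 simp: abs_of_pos add_pos_pos\<close>)
  have "(\<integral>x. exp (a * \<bar>x\<bar>) \<partial>?N) \<le> (\<integral>x. exp (a * x) + exp (- a * x) \<partial>?N)"
    using I sum le by (intro integral_mono)
  also have "\<dots> = 2 * exp (a\<^sup>2 * s\<^sup>2 / 2)"
    using int by (subst Bochner_Integration.integral_add) (simp_all only: val, simp)
  finally show ?L .
qed

text \<open>Splits an exponential of a sum into exponentials of single variables, at the price of
  doubling the rates.\<close>

lemma exp_midpoint_le: "exp ((x + y) / 2) \<le> (exp x + exp y) / 2" for x y :: real
  using convex_onD[OF exp_convex, of "1/2" x y] by (simp add: field_simps)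

lemma prob_space_complex_gaussian: "0 < v \<Longrightarrow> prob_space (complex_gaussian v)"
  unfolding complex_gaussian_def
  by (intro prob_space.prob_space_distr prob_space_pair prob_space_normal_density)
    (simp_all add: Complex_eq case_prod_beta')

lemma sets_complex_gaussian [measurable_cong]: "sets (complex_gaussian v) = sets borel"
  by (simp add: complex_gaussian_def)

text \<open>The modulus is at most the sum of the absolute values of both parts, which midpoint
  convexity separates. Rate \<open>2 * a\<close> and variance \<open>v / 2\<close> give the exponent
  \<open>(2 * a)^2 * (v / 2) / 2 = a^2 * v\<close>.\<close>

lemma complex_gaussian_exp_cmod:
  assumes "0 < v" "0 \<le> a"
  shows integrable_complex_gaussian_exp_cmod:
      "integrable (complex_gaussian v) (\<lambda>z. exp (a * cmod z))" (is ?I)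
    and integral_complex_gaussian_exp_cmod_le:
      "(\<integral>z. exp (a * cmod z) \<partial>complex_gaussian v) \<le> 2 * exp (a\<^sup>2 * v)" (is ?L)
proof -
  let ?N = "density lborel (normal_density 0 (sqrt (v / 2)))"
  let ?P = "?N \<Otimes>\<^sub>M ?N"
  let ?e = "\<lambda>x. exp ((2 * a) * \<bar>x\<bar>) :: real"
  interpret N: prob_space ?N
    using assms by (intro prob_space_normal_density) simp
  interpret NN: pair_sigma_finite ?N ?N ..
  have s: "0 < sqrt (v / 2)" using assms by simp
  note N_int = integrable_normal_exp_abs[OF s, of "2 * a"]
  have "(\<integral>x. ?e x \<partial>?N) \<le> 2 * exp ((2 * a)\<^sup>2 * (sqrt (v / 2))\<^sup>2 / 2)"
    by (rule integral_normal_exp_abs_le[OF s])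
  also have "(2 * a)\<^sup>2 * (sqrt (v / 2))\<^sup>2 / 2 = a\<^sup>2 * v"
    using assms by (simp add: power2_eq_square)
  finally have N_le: "(\<integral>x. ?e x \<partial>?N) \<le> 2 * exp (a\<^sup>2 * v)" .
  have fst_int: "integrable ?P (\<lambda>z. ?e (fst z))"
    using N_int by (intro integrable_distr[of fst ?P ?N]) (simp_all add: N.distr_pair_fst)
  have fst_val: "(\<integral>z. ?e (fst z) \<partial>?P) = (\<integral>x. ?e x \<partial>?N)"
    using integral_distr[of fst ?P ?N ?e] by (simp add: N.distr_pair_fst)
  \<comment> \<open>Both factors are the same measure, so swapping them transfers the result from
    the first coordinate.\<close>
  have snd_int: "integrable ?P (\<lambda>z. ?e (snd z))"
    using NN.integrable_product_swap[OF fst_int] by (simp add: case_prod_beta')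
  have snd_val: "(\<integral>z. ?e (snd z) \<partial>?P) = (\<integral>x. ?e x \<partial>?N)"
    using NN.integral_product_swap[of "\<lambda>z. ?e (fst z)"] fst_val by (simp add: case_prod_beta')
  have le: "exp (a * cmod (case z of (x, y) \<Rightarrow> Complex x y)) \<le> (?e (fst z) + ?e (snd z)) / 2" for z
  proof -
    have "cmod (case z of (x, y) \<Rightarrow> Complex x y) \<le> \<bar>fst z\<bar> + \<bar>snd z\<bar>"
      using cmod_le[of "Complex (fst z) (snd z)"] by (simp add: case_prod_beta)
    then have "a * cmod (case z of (x, y) \<Rightarrow> Complex x y) \<le> a * (\<bar>fst z\<bar> + \<bar>snd z\<bar>)"
      using assms(2) by (rule mult_left_mono)
    then have "exp (a * cmod (case z of (x, y) \<Rightarrow> Complex x y))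
        \<le> exp (((2 * a) * \<bar>fst z\<bar> + (2 * a) * \<bar>snd z\<bar>) / 2)"
      by (simp add: algebra_simps)
    also note exp_midpoint_le
    finally show ?thesis .
  qed
  have sum: "integrable ?P (\<lambda>z. (?e (fst z) + ?e (snd z)) / 2)"
    using fst_int snd_int by simp
  have meas [measurable]: "(\<lambda>(x, y). Complex x y) \<in> ?P \<rightarrow>\<^sub>M borel"
    by (simp add: Complex_eq case_prod_beta')
  have P_int: "integrable ?P (\<lambda>z. exp (a * cmod (case z of (x, y) \<Rightarrow> Complex x y)))"
    by (rule Bochner_Integration.integrable_bound[OF sum]) (use le in \<open>auto intro: AE_I2 simp: abs_of_pos add_pos_pos\<close>)
  show ?I
    unfolding complex_gaussian_def using P_int by (subst integrable_distr_eq) simp_all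
  have "(\<integral>z. exp (a * cmod z) \<partial>complex_gaussian v)
      = (\<integral>z. exp (a * cmod (case z of (x, y) \<Rightarrow> Complex x y)) \<partial>?P)"
    unfolding complex_gaussian_def by (subst integral_distr) simp_all
  also have "\<dots> \<le> (\<integral>z. (?e (fst z) + ?e (snd z)) / 2 \<partial>?P)"
    using P_int sum le by (intro integral_mono)
  also have "\<dots> = (\<integral>x. ?e x \<partial>?N)"
    using fst_int snd_int fst_val snd_val by simp
  finally show ?L using N_le by simp
qed

text \<open>Only one coordinate occurs, and its marginal under the product measure is the single
  complex Gaussian.\<close>

lemma readout_noise_exp_cmod:
  assumes "0 < \<sigma>" "0 < \<mu>" "0 < B" "0 \<le> a"
  shows integrable_readout_noise_exp_cmod:
      "integrable (readout_noise \<sigma> \<mu> B) (\<lambda>\<zeta>. exp (a * cmod (\<zeta> l)))" (is ?I)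
    and integral_readout_noise_exp_cmod_le:
      "(\<integral>\<zeta>. exp (a * cmod (\<zeta> l)) \<partial>readout_noise \<sigma> \<mu> B) \<le> 2 * exp (a\<^sup>2 * (\<sigma>\<^sup>2 / (\<mu>\<^sup>2 * B)))" (is ?L)
proof -
  define v where "v = \<sigma>\<^sup>2 / (\<mu>\<^sup>2 * B)"
  have v: "0 < v" using assms by (simp add: v_def)
  let ?G = "complex_gaussian v" and ?M = "Pi\<^sub>M UNIV (\<lambda>_::nat. complex_gaussian v)"
  have noise: "readout_noise \<sigma> \<mu> B = ?M" by (simp add: readout_noise_def v_def)
  have marginal: "distr ?M ?G (\<lambda>\<zeta>. \<zeta> l) = ?G"
    using prob_space_complex_gaussian[OF v] by (intro distr_PiM_component) simp_all
  have coord: "(\<lambda>\<zeta>. \<zeta> l) \<in> ?M \<rightarrow>\<^sub>M ?G" by simp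
  show ?I
    using integrable_complex_gaussian_exp_cmod[OF v assms(4)]
    unfolding noise by (intro integrable_distr[OF coord]) (simp add: marginal)
  have "(\<integral>\<zeta>. exp (a * cmod (\<zeta> l)) \<partial>?M) = (\<integral>z. exp (a * cmod z) \<partial>?G)"
    by (subst (2) marginal[symmetric], subst integral_distr[OF coord]) simp_all
  then show ?L
    using integral_complex_gaussian_exp_cmod_le[OF v assms(4)] unfolding noise by (simp add: v_def)
qed

lemma measurable_readout_noise [measurable]: "(\<lambda>\<zeta>. \<zeta> l) \<in> borel_measurable (readout_noise \<sigma> \<mu> B)"
proof -
  have "(\<lambda>\<zeta>. \<zeta> l) \<in> readout_noise \<sigma> \<mu> B \<rightarrow>\<^sub>M complex_gaussian (\<sigma>\<^sup>2 / (\<mu>\<^sup>2 * B))"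
    unfolding readout_noise_def by simp
  then show ?thesis by (simp cong: measurable_cong_sets add: sets_complex_gaussian)
qed

section \<open>Perturbed products of unit factors\<close>

text \<open>Errors are measured as \<open>exp a - 1\<close> because
  \<open>(1 + (exp a - 1)) * (1 + (exp b - 1)) = exp (a + b)\<close>: multiplying factors then
  merely adds exponents.\<close>

lemma norm_mult_diff_le_exp:
  fixes X Y U W :: complex
  assumes "cmod (X - U) \<le> exp a - 1" "cmod (Y - W) \<le> exp b - 1" "cmod U = 1" "cmod W = 1"
  shows "cmod (X * Y - U * W) \<le> exp (a + b) - 1"
proof -
  have "X * Y - U * W = (X - U) * (Y - W) + (X - U) * W + U * (Y - W)"
    by (simp add: algebra_simps)
  then have "cmod (X * Y - U * W) \<le> cmod (X - U) * cmod (Y - W) + cmod (X - U) + cmod (Y - W)"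
    using norm_triangle_ineq[of "(X - U) * (Y - W) + (X - U) * W" "U * (Y - W)"]
      norm_triangle_ineq[of "(X - U) * (Y - W)" "(X - U) * W"] assms(3,4)
    by (simp add: norm_mult)
  also have "\<dots> \<le> (exp a - 1) * (exp b - 1) + (exp a - 1) + (exp b - 1)"
    using assms(1,2) order_trans[OF norm_ge_zero assms(1)] by (intro add_mono mult_mono) auto
  also have "\<dots> = exp (a + b) - 1"
    by (simp add: exp_add algebra_simps)
  finally show ?thesis .
qed

text \<open>A single factor enters with exponent \<open>cmod (f x - g x)\<close>, since
  \<open>u \<le> exp u - 1\<close>; the exponents add over multiplicities and over factors.\<close>

lemma norm_prod_power_diff_le_exp:
  fixes f g :: "'a \<Rightarrow> complex"
  assumes "finite A" "\<And>x. x \<in> A \<Longrightarrow> cmod (g x) = 1"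
  shows "cmod ((\<Prod>x\<in>A. f x ^ p x) - (\<Prod>x\<in>A. g x ^ p x)) \<le> exp (\<Sum>x\<in>A. real (p x) * cmod (f x - g x)) - 1"
  using assms
proof (induction A rule: finite_induct)
  case (insert x A)
  have pow: "cmod (f x ^ m - g x ^ m) \<le> exp (real m * cmod (f x - g x)) - 1" for m
  proof (induction m)
    case (Suc m)
    have "cmod (f x - g x) \<le> exp (cmod (f x - g x)) - 1"
      using exp_ge_add_one_self[of "cmod (f x - g x)"] by linarith
    from norm_mult_diff_le_exp[OF this Suc.IH] insert.prems show ?case
      by (simp add: norm_power algebra_simps)
  qed simp
  have "cmod (\<Prod>x\<in>A. g x ^ p x) = 1"
    using insert.prems by (simp add: norm_power flip: prod_norm)
  with norm_mult_diff_le_exp[OF pow[of "p x"] insert.IH] insert show ?case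
    by (simp add: norm_power)
qed simp

text \<open>Jensen's inequality decouples the factors, so that only the law of each single readout error
  matters below, and neither their independence nor the degree of the product.\<close>

lemma norm_prod_power_diff_sq_le:
  fixes f g :: "'a \<Rightarrow> complex" and y :: "'b \<Rightarrow> real"
  assumes "finite A" and unit: "\<And>x. x \<in> A \<Longrightarrow> cmod (g x) = 1"
    and err: "\<And>x. x \<in> A \<Longrightarrow> cmod (f x - g x) \<le> b + h * (y (i x) + y (j x))"
    and k: "k = (\<Sum>x\<in>A. real (p x))" "0 < k" and t: "0 < t" "t \<le> 1" "k * b \<le> t"
  shows "(cmod ((\<Prod>x\<in>A. f x ^ p x) - (\<Prod>x\<in>A. g x ^ p x)))\<^sup>2
    \<le> t\<^sup>2 * exp 2 * (\<Sum>x\<in>A. real (p x) / k * ((exp (4 * k * h / t * y (i x)) + exp (4 * k * h / t * y (j x))) / 2))"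
proof -
  define S where "S = (\<Sum>x\<in>A. real (p x) * cmod (f x - g x))"
  define c where "c = 4 * k * h / t"
  define m where "m x = (c * y (i x) + c * y (j x)) / 2" for x
  have "A \<noteq> {}" using k by auto
  \<comment> \<open>Convexity between 0 and \<open>S / t\<close> extracts the small prefactor
    \<open>t\<close> from \<open>exp S - 1\<close>, at the price of a larger rate in the
    exponential.\<close>
  have "exp S = exp ((1 - t) *\<^sub>R 0 + t *\<^sub>R (S / t))" using t by simp
  also have "\<dots> \<le> (1 - t) * exp 0 + t * exp (S / t)"
    using t by (intro convex_onD[OF exp_convex]) auto
  finally have "exp S - 1 \<le> t * exp (S / t)" using t by simp
  then have "cmod ((\<Prod>x\<in>A. f x ^ p x) - (\<Prod>x\<in>A. g x ^ p x)) \<le> t * exp (S / t)"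
    using norm_prod_power_diff_le_exp[where f = f and g = g and p = p, OF assms(1) unit] unfolding S_def by linarith
  then have "(cmod ((\<Prod>x\<in>A. f x ^ p x) - (\<Prod>x\<in>A. g x ^ p x)))\<^sup>2 \<le> (t * exp (S / t))\<^sup>2"
    by (intro power_mono) auto
  also have "(t * exp (S / t))\<^sup>2 = t\<^sup>2 * exp (2 * S / t)"
    unfolding power_mult_distrib exp_double[symmetric] by simp
  finally have sq: "(cmod ((\<Prod>x\<in>A. f x ^ p x) - (\<Prod>x\<in>A. g x ^ p x)))\<^sup>2 \<le> t\<^sup>2 * exp (2 * S / t)" .
  have "S \<le> (\<Sum>x\<in>A. real (p x) * (b + h * (y (i x) + y (j x))))"
    unfolding S_def using err by (intro sum_mono mult_left_mono) auto
  also have "\<dots> = k * b + (\<Sum>x\<in>A. real (p x) * (h * (y (i x) + y (j x))))"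
    by (simp add: k(1) distrib_left sum.distrib sum_distrib_right)
  \<comment> \<open>The total bias \<open>k * b\<close> is at most \<open>t\<close> and contributes
    at most 2 to the exponent, which is the origin of \<open>exp 2\<close>.\<close>
  finally have "2 * S / t \<le> 2 * (t + (\<Sum>x\<in>A. real (p x) * (h * (y (i x) + y (j x))))) / t"
    using t by (intro divide_right_mono) auto
  also have "\<dots> = 2 + 2 / t * (\<Sum>x\<in>A. real (p x) * (h * (y (i x) + y (j x))))"
    using t(1) by (simp add: field_simps)
  \<comment> \<open>The sum is rewritten as a convex combination with weights
    \<open>p x / k\<close>. The factor \<open>k\<close> this requires and the halving in
    \<open>m\<close> account for \<open>c = 4 * k * h / t\<close>.\<close>
  also have "2 / t * (\<Sum>x\<in>A. real (p x) * (h * (y (i x) + y (j x)))) = (\<Sum>x\<in>A. (real (p x) / k) *\<^sub>R m x)"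
    unfolding sum_distrib_left
  proof (rule sum.cong[OF refl])
    fix x
    show "2 / t * (real (p x) * (h * (y (i x) + y (j x)))) = (real (p x) / k) *\<^sub>R m x"
      using t(1) k(2) by (simp add: m_def c_def field_simps)
  qed
  finally have "exp (2 * S / t) \<le> exp 2 * exp (\<Sum>x\<in>A. (real (p x) / k) *\<^sub>R m x)"
    by (simp flip: exp_add)
  also have "\<dots> \<le> exp 2 * (\<Sum>x\<in>A. real (p x) / k * ((exp (c * y (i x)) + exp (c * y (j x))) / 2))"
  proof (rule mult_left_mono)
    have "(\<Sum>x\<in>A. real (p x) / k) = 1"
      using k by (simp flip: sum_divide_distrib)
    then have "exp (\<Sum>x\<in>A. (real (p x) / k) *\<^sub>R m x) \<le> (\<Sum>x\<in>A. real (p x) / k * exp (m x))"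
      using k(2) \<open>A \<noteq> {}\<close> assms(1)
      by (intro convex_on_sum[where a = "\<lambda>x. real (p x) / k" and y = m, OF _ _ exp_convex]) auto
    also have "\<dots> \<le> (\<Sum>x\<in>A. real (p x) / k * ((exp (c * y (i x)) + exp (c * y (j x))) / 2))"
      unfolding m_def using k(2) by (intro sum_mono mult_left_mono exp_midpoint_le) auto
    finally show "exp (\<Sum>x\<in>A. (real (p x) / k) *\<^sub>R m x)
        \<le> (\<Sum>x\<in>A. real (p x) / k * ((exp (c * y (i x)) + exp (c * y (j x))) / 2))" .
  qed simp
  finally have "t\<^sup>2 * exp (2 * S / t)
      \<le> t\<^sup>2 * (exp 2 * (\<Sum>x\<in>A. real (p x) / k * ((exp (c * y (i x)) + exp (c * y (j x))) / 2)))"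
    by (rule mult_left_mono) simp
  with sq show ?thesis unfolding c_def mult.assoc[of _ "exp 2"] by (rule order_trans)
qed

section \<open>The monomial of a pattern\<close>

text \<open>Negative entries become powers of the conjugate feature, because the inverse of a unit
  phase is its conjugate. At each lag at most one of the two exponents is nonzero.\<close>

definition pattern_monom :: "(nat \<Rightarrow> int) \<Rightarrow> (nat + nat) \<Rightarrow>\<^sub>0 nat" where
  "pattern_monom n = Abs_poly_mapping (case_sum (\<lambda>l. nat (n l)) (\<lambda>l. nat (- n l)))"

text \<open>The default \<open>Inr l\<close> also covers \<open>n l = 0\<close>, where its exponent
  is zero.\<close>

definition pattern_var :: "(nat \<Rightarrow> int) \<Rightarrow> nat \<Rightarrow> nat + nat" where
  "pattern_var n l = (if 0 < n l then Inl l else Inr l)"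

lemma inj_pattern_var: "inj_on (pattern_var n) A"
  by (auto simp: inj_on_def pattern_var_def split: if_splits)

context
  fixes n :: "nat \<Rightarrow> int"
  assumes fin: "finite {l. n l \<noteq> 0}"
begin

lemma lookup_pattern_monom:
  "Poly_Mapping.lookup (pattern_monom n) = case_sum (\<lambda>l. nat (n l)) (\<lambda>l. nat (- n l))"
proof -
  have "{x. case_sum (\<lambda>l. nat (n l)) (\<lambda>l. nat (- n l)) x \<noteq> 0} \<subseteq> Inl ` {l. n l \<noteq> 0} \<union> Inr ` {l. n l \<noteq> 0}"
  proof
    fix x assume "x \<in> {x. case_sum (\<lambda>l. nat (n l)) (\<lambda>l. nat (- n l)) x \<noteq> 0}"
    then show "x \<in> Inl ` {l. n l \<noteq> 0} \<union> Inr ` {l. n l \<noteq> 0}" by (cases x) auto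
  qed
  then have "finite {x. case_sum (\<lambda>l. nat (n l)) (\<lambda>l. nat (- n l)) x \<noteq> 0}"
    by (rule finite_subset) (use fin in simp)
  then show ?thesis
    by (simp add: pattern_monom_def Abs_poly_mapping_inverse)
qed

lemma lookup_pattern_var: "Poly_Mapping.lookup (pattern_monom n) (pattern_var n l) = nat \<bar>n l\<bar>"
  by (auto simp: lookup_pattern_monom pattern_var_def)

lemma keys_pattern_monom: "Poly_Mapping.keys (pattern_monom n) = pattern_var n ` {l. n l \<noteq> 0}"
proof -
  have "x \<in> pattern_var n ` {l. n l \<noteq> 0}" if "Poly_Mapping.lookup (pattern_monom n) x \<noteq> 0" for x
  proof (cases x)
    case (Inl l)
    then show ?thesis using that by (intro image_eqI[of _ _ l]) (auto simp: lookup_pattern_monom pattern_var_def)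
  next
    case (Inr l)
    then show ?thesis using that by (intro image_eqI[of _ _ l]) (auto simp: lookup_pattern_monom pattern_var_def)
  qed
  then show ?thesis by (auto simp: in_keys_iff lookup_pattern_var)
qed

lemma monom_degree_pattern_monom: "monom_degree (pattern_monom n) = weight n"
  unfolding monom_degree_def weight_def keys_pattern_monom
  by (subst sum.reindex[OF inj_pattern_var]) (simp add: lookup_pattern_var)

lemma total_degree_pattern_monom: "total_degree (Poly_Mapping.single (pattern_monom n) 1) = weight n"
  by (simp add: total_degree_def monom_degree_pattern_monom)

lemma estimate_pattern_monom:
  "estimate (Poly_Mapping.single (pattern_monom n) 1) g =
    (\<Prod>x\<in>Poly_Mapping.keys (pattern_monom n).
      case_sum g (\<lambda>l. cnj (g l)) x ^ Poly_Mapping.lookup (pattern_monom n) x)"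
  by (simp add: estimate_def cpoly_eval_def)

text \<open>Puts the target into the same product form as the estimator, with ideal phases in place
  of features, so that the two can be compared factor by factor.\<close>

lemma pattern_exp_eq_prod:
  "pattern_exp \<beta> n s =
    (\<Prod>x\<in>Poly_Mapping.keys (pattern_monom n).
      case_sum (\<lambda>l. exp (\<i> * of_real (\<beta> * s l))) (\<lambda>l. cnj (exp (\<i> * of_real (\<beta> * s l)))) x
        ^ Poly_Mapping.lookup (pattern_monom n) x)"
  unfolding keys_pattern_monom
proof (subst prod.reindex[OF inj_pattern_var], unfold pattern_exp_def, rule prod.cong[OF refl])
  fix l
  have pos: "exp (\<i> * of_real (\<beta> * of_int (n l) * s l)) = exp (\<i> * of_real (\<beta> * s l)) ^ nat (n l)" if "0 < n l"
    using that by (simp flip: exp_of_nat_mult add: mult_ac)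
  have neg: "exp (\<i> * of_real (\<beta> * of_int (n l) * s l)) = cnj (exp (\<i> * of_real (\<beta> * s l))) ^ nat (- n l)" if "\<not> 0 < n l"
    using that by (simp flip: exp_of_nat_mult add: exp_cnj mult_ac)
  show "exp (\<i> * of_real (\<beta> * of_int (n l) * s l)) =
    ((\<lambda>x. case_sum (\<lambda>l. exp (\<i> * of_real (\<beta> * s l))) (\<lambda>l. cnj (exp (\<i> * of_real (\<beta> * s l)))) x
        ^ Poly_Mapping.lookup (pattern_monom n) x) \<circ> pattern_var n) l"
    using pos neg by (simp add: lookup_pattern_monom pattern_var_def)
qed

end

section \<open>Mean square error of the estimator\<close>

text \<open>The pointwise estimate for perturbed products is integrated with the moduli of the
  readout errors as \<open>y\<close>. Assumption \<open>var\<close> bounds the Gaussian exponent by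
  2, so each exponential moment is at most \<open>2 * exp 2\<close>; the other \<open>exp 2\<close>
  comes from the bias.\<close>

lemma pattern_estimator_mse:
  fixes n :: "nat \<Rightarrow> int" and p :: "(nat + nat) cpoly"
  defines "k \<equiv> real (weight n)" and "p \<equiv> Poly_Mapping.single (pattern_monom n) 1"
  assumes \<eta>: "0 < \<eta>" "\<eta> < 1" and r: "0 < r" "rho_bar \<eta> r < 1"
    and noise: "0 < \<sigma>" "0 < \<mu>" "0 < B" and n: "finite {l. n l \<noteq> 0}" "0 < weight n"
    and t: "0 < t" "t \<le> 1"
    and bias: "k * (2 * (sinh (2 * r))\<^sup>2 / (1 - rho_bar \<eta> r)\<^sup>2) \<le> t"
    and var: "(4 * k * (1 / \<bar>fir_gain \<eta> r\<bar>) / t)\<^sup>2 * (\<sigma>\<^sup>2 / (\<mu>\<^sup>2 * B)) \<le> 2"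
  shows "integrable (readout_noise \<sigma> \<mu> B)
      (\<lambda>\<zeta>. (cmod (estimate p (measured_feature \<eta> \<beta> r \<phi> s \<zeta>) - pattern_exp \<beta> n s))\<^sup>2)" (is "integrable ?M ?f")
    and "(\<integral>\<zeta>. (cmod (estimate p (measured_feature \<eta> \<beta> r \<phi> s \<zeta>) - pattern_exp \<beta> n s))\<^sup>2
      \<partial>readout_noise \<sigma> \<mu> B) \<le> 2 * exp 4 * t\<^sup>2" (is ?L)
proof -
  define a where "a = 4 * k * (1 / \<bar>fir_gain \<eta> r\<bar>) / t"
  define A where "A = Poly_Mapping.keys (pattern_monom n)"
  define q where "q = Poly_Mapping.lookup (pattern_monom n)"
  \<comment> \<open>A feature and its conjugate involve the same two readout errors, at
    \<open>lag x\<close> and \<open>Suc (lag x)\<close>.\<close>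
  define lag :: "nat + nat \<Rightarrow> nat" where "lag = case_sum id id"
  define F where "F \<zeta> = (\<Sum>x\<in>A. real (q x) / k * ((exp (a * cmod (\<zeta> (lag x))) + exp (a * cmod (\<zeta> (Suc (lag x))))) / 2))"
    for \<zeta> :: "nat \<Rightarrow> complex"
  have a: "0 \<le> a" using t by (simp add: a_def k_def)
  have k: "k = (\<Sum>x\<in>A. real (q x))" "0 < k"
    using n monom_degree_pattern_monom[OF n(1)]
    by (simp_all add: k_def A_def q_def monom_degree_def flip: of_nat_sum)
  have int: "integrable ?M (\<lambda>\<zeta>. exp (a * cmod (\<zeta> l)))" for l
    using noise a by (rule integrable_readout_noise_exp_cmod)
  have val: "(\<integral>\<zeta>. exp (a * cmod (\<zeta> l)) \<partial>?M) \<le> 2 * exp 2" for l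
    using integral_readout_noise_exp_cmod_le[OF noise a, of l] var unfolding a_def[symmetric]
    by (meson exp_le_cancel_iff mult_left_mono order_trans zero_le_numeral)
  have bound: "?f \<zeta> \<le> t\<^sup>2 * exp 2 * F \<zeta>" for \<zeta>
    unfolding estimate_pattern_monom[OF n(1)] pattern_exp_eq_prod[OF n(1)] p_def F_def a_def
      A_def[symmetric] q_def[symmetric]
  proof (rule norm_prod_power_diff_sq_le[OF _ _ _ k t bias])
    show "finite A" by (simp add: A_def)
    fix x
    show "cmod (case_sum (\<lambda>l. exp (\<i> * of_real (\<beta> * s l))) (\<lambda>l. cnj (exp (\<i> * of_real (\<beta> * s l)))) x) = 1"
      by (cases x) (simp_all add: norm_exp_eq_Re)
    show "cmod (case_sum (measured_feature \<eta> \<beta> r \<phi> s \<zeta>) (\<lambda>l. cnj (measured_feature \<eta> \<beta> r \<phi> s \<zeta> l)) x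
        - case_sum (\<lambda>l. exp (\<i> * of_real (\<beta> * s l))) (\<lambda>l. cnj (exp (\<i> * of_real (\<beta> * s l)))) x)
      \<le> 2 * (sinh (2 * r))\<^sup>2 / (1 - rho_bar \<eta> r)\<^sup>2
        + 1 / \<bar>fir_gain \<eta> r\<bar> * (cmod (\<zeta> (lag x)) + cmod (\<zeta> (Suc (lag x))))"
    proof -
      have "cmod (cnj z - cnj w) = cmod (z - w)" for z w
        by (metis complex_cnj_diff complex_mod_cnj)
      then show ?thesis
        using measured_feature_error[OF \<eta> r, of \<beta> \<phi> s \<zeta> "lag x"]
        by (cases x) (simp_all only: lag_def sum.case id_apply)
    qed
  qed
  have F_int: "integrable ?M F"
    unfolding F_def using int by (intro Bochner_Integration.integrable_sum integrable_mult_right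
        integrable_divide Bochner_Integration.integrable_add)
  have "(\<lambda>\<zeta>. measured_feature \<eta> \<beta> r \<phi> s \<zeta> l) \<in> borel_measurable ?M" for l
    unfolding measured_feature_def measured_moment_def by measurable
  moreover have "(cnj :: complex \<Rightarrow> complex) \<in> borel_measurable borel"
    by (intro borel_measurable_continuous_onI continuous_intros)
  ultimately have "(\<lambda>\<zeta>. case_sum (measured_feature \<eta> \<beta> r \<phi> s \<zeta>) (\<lambda>l. cnj (measured_feature \<eta> \<beta> r \<phi> s \<zeta> l)) x)
      \<in> borel_measurable ?M" for x
    by (cases x) (simp_all add: measurable_compose)
  then have meas: "?f \<in> borel_measurable ?M"
    unfolding p_def estimate_pattern_monom[OF n(1)]
    by (intro borel_measurable_power borel_measurable_norm borel_measurable_diff borel_measurable_prod) simp_all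
  show I: "integrable ?M ?f"
  proof (rule Bochner_Integration.integrable_bound[OF integrable_mult_right[OF F_int] meas])
    show "AE \<zeta> in ?M. norm (?f \<zeta>) \<le> norm (t\<^sup>2 * exp 2 * F \<zeta>)"
    proof (rule AE_I2)
      fix \<zeta>
      have "norm (?f \<zeta>) = ?f \<zeta>" by simp
      with bound[of \<zeta>] show "norm (?f \<zeta>) \<le> norm (t\<^sup>2 * exp 2 * F \<zeta>)" by simp
    qed
  qed
  have "(\<integral>\<zeta>. F \<zeta> \<partial>?M) = (\<Sum>x\<in>A. real (q x) / k *
      (((\<integral>\<zeta>. exp (a * cmod (\<zeta> (lag x))) \<partial>?M) + (\<integral>\<zeta>. exp (a * cmod (\<zeta> (Suc (lag x)))) \<partial>?M)) / 2))"
    unfolding F_def using int by simp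
  also have "\<dots> \<le> (\<Sum>x\<in>A. real (q x) / k * ((2 * exp 2 + 2 * exp 2) / 2))"
    using val k(2) by (intro sum_mono mult_left_mono divide_right_mono add_mono) auto
  also have "\<dots> = 2 * exp 2"
    using k by (simp flip: sum_divide_distrib sum_distrib_right)
  finally have F_le: "(\<integral>\<zeta>. F \<zeta> \<partial>?M) \<le> 2 * exp 2" .
  have "(\<integral>\<zeta>. ?f \<zeta> \<partial>?M) \<le> (\<integral>\<zeta>. t\<^sup>2 * exp 2 * F \<zeta> \<partial>?M)"
    using I F_int bound by (intro integral_mono) auto
  also have "\<dots> = t\<^sup>2 * exp 2 * (\<integral>\<zeta>. F \<zeta> \<partial>?M)" by simp
  also have "\<dots> \<le> t\<^sup>2 * exp 2 * (2 * exp 2)"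
    using F_le by (intro mult_left_mono) auto
  also have "\<dots> = 2 * exp 4 * t\<^sup>2"
    by (simp add: mult_ac flip: exp_add)
  finally show ?L .
qed

section \<open>Choice of squeezing, accuracy scale and shot budget\<close>

theorem corollary5:
  fixes \<eta> :: real
  assumes "0 < \<eta>" and "\<eta> < 1"
  shows "\<exists>c::real. \<forall>(\<beta>::real) (smax::real) (\<sigma>::real) (\<mu>::real) (n::nat \<Rightarrow> int) (\<epsilon>::real).
    0 < \<beta> \<longrightarrow> 0 < smax \<longrightarrow> \<beta> * smax < pi \<longrightarrow> 0 < \<sigma> \<longrightarrow> 0 < \<mu> \<longrightarrow>
    finite {l. n l \<noteq> 0} \<longrightarrow> 1 \<le> weight n \<longrightarrow> 0 < \<epsilon> \<longrightarrow> \<epsilon> < 1 \<longrightarrow>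
    (\<exists>(\<phi>::nat \<Rightarrow> real) (r::real) (p::(nat + nat) cpoly) (B::real).
       guard_compatible \<eta> \<phi> r \<and>
       total_degree p = weight n \<and>
       0 < B \<and>
       B \<le> c * (\<sigma> / \<mu>)\<^sup>2 * real (weight n) ^ 3
             * (1 + v_inf \<eta> r) ^ (3 * (weight n - 1)) / \<epsilon> ^ 3 \<and>
       (\<forall>s\<in>inputs smax.
          integrable (readout_noise \<sigma> \<mu> B)
            (\<lambda>\<zeta>. (cmod (estimate p (measured_feature \<eta> \<beta> r \<phi> s \<zeta>) - pattern_exp \<beta> n s))\<^sup>2) \<and>
          sqrt (\<integral>\<zeta>. (cmod (estimate p (measured_feature \<eta> \<beta> r \<phi> s \<zeta>) - pattern_exp \<beta> n s))\<^sup>2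
                 \<partial>readout_noise \<sigma> \<mu> B) \<le> \<epsilon>))"
\<comment> \<open>The constant depends on \<open>\<eta>\<close> only. The power of two is
  \<open>2 ^ 16\<close> from the squared noise rate times \<open>2 ^ 8\<close> from
  \<open>\<tau>^2\<close>, divided by the permitted exponent 2.\<close>
proof (rule exI[of _ "2 ^ 23 / (\<eta>\<^sup>2 * (1 - \<eta>)\<^sup>2)"], intro allI impI)
  fix \<beta> smax \<sigma> \<mu> \<epsilon> :: real and n :: "nat \<Rightarrow> int"
  assume noise: "0 < \<sigma>" "0 < \<mu>" and n: "finite {l. n l \<noteq> 0}" "1 \<le> weight n" and \<epsilon>: "0 < \<epsilon>" "\<epsilon> < 1"
  define c where "c = 2 ^ 23 / (\<eta>\<^sup>2 * (1 - \<eta>)\<^sup>2)"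
  define k where "k = real (weight n)"
  \<comment> \<open>\<open>\<tau>\<close> will be \<open>sinh (2 * r)\<close>. The root makes
    \<open>k * \<tau>^2\<close> proportional to \<open>\<epsilon>\<close>, the factor
    \<open>1 - \<eta>\<close> secures the guard, and 16 makes the total bias bound equal to
    \<open>t\<close>.\<close>
  define \<tau> where "\<tau> = (1 - \<eta>) / 16 * sqrt (\<epsilon> / k)"
  define r where "r = arsinh \<tau> / 2"
  define B where "B = c * (\<sigma> / \<mu>)\<^sup>2 * k ^ 3 / \<epsilon> ^ 3"
  \<comment> \<open>Small enough for \<open>2 * exp 4 * t^2 \<le> \<epsilon>^2\<close>, as
    \<open>exp 4 \<le> 81\<close>.\<close>
  define t where "t = \<epsilon> / 32"
  define p :: "(nat + nat) cpoly" where "p = Poly_Mapping.single (pattern_monom n) 1"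
  have k: "1 \<le> k" using n by (simp add: k_def)
  have c: "0 < c" using assms by (simp add: c_def)
  have B: "0 < B" using c noise k \<epsilon> by (simp add: B_def)
  have sinh: "sinh (2 * r) = \<tau>" by (simp add: r_def sinh_arsinh_real)
  have "sqrt (\<epsilon> / k) \<le> 1" using \<epsilon> k by simp
  then have \<tau>: "0 < \<tau>" "\<tau> \<le> (1 - \<eta>) / 16"
    using assms \<epsilon> k by (auto simp: \<tau>_def intro: mult_left_le)
  have \<tau>_sq: "\<tau>\<^sup>2 = (1 - \<eta>)\<^sup>2 * \<epsilon> / (256 * k)"
    using \<epsilon> k by (simp add: \<tau>_def power_mult_distrib power_divide)
  have r: "0 < r"
    using \<tau> sinh by (metis sinh_real_pos_iff zero_less_mult_pos zero_less_numeral)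
  \<comment> \<open>Gives \<open>exp (2 * r) \<le> 1 + 2 * \<tau>\<close>, so \<open>rho_bar\<close>
    exceeds \<open>\<eta>\<close> by at most \<open>(1 - \<eta>) / 8\<close> and the guard keeps a
    margin that depends only on \<open>\<eta>\<close>.\<close>
  have "sqrt (\<tau>\<^sup>2 + 1) \<le> 1 + \<tau>"
    using \<tau> by (intro real_le_lsqrt) (auto simp: power2_eq_square algebra_simps)
  moreover have "exp (2 * r) = \<tau> + sqrt (\<tau>\<^sup>2 + 1)"
    using \<tau> by (simp add: r_def arsinh_real_def add_pos_nonneg)
  ultimately have "\<eta> * exp (2 * r) \<le> \<eta> * (1 + 2 * \<tau>)"
    using assms by (intro mult_left_mono) auto
  also have "\<dots> \<le> \<eta> + 2 * \<tau>"
    using assms \<tau> by (simp add: algebra_simps mult_left_le_one_le)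
  finally have \<rho>: "(1 - \<eta>) / 2 \<le> 1 - rho_bar \<eta> r"
    using \<tau> assms by (simp add: rho_bar_def field_simps)
  moreover have "0 < (1 - \<eta>) / 2" using assms by simp
  ultimately have guard: "rho_bar \<eta> r < 1" by linarith
  have "2 * (sinh (2 * r))\<^sup>2 / (1 - rho_bar \<eta> r)\<^sup>2 \<le> 2 * \<tau>\<^sup>2 / ((1 - \<eta>) / 2)\<^sup>2"
    unfolding sinh using \<rho> assms by (intro divide_left_mono power_mono) auto
  also have "\<dots> = \<epsilon> / (32 * k)"
    using assms unfolding \<tau>_sq by (simp add: power_divide)
  finally have bias: "k * (2 * (sinh (2 * r))\<^sup>2 / (1 - rho_bar \<eta> r)\<^sup>2) \<le> t"
    using k by (simp add: t_def field_simps)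
  have d: "0 < 1 - \<eta> * cosh (2 * r)"
    using eta_cosh_le_rho[OF assms r guard] guard by linarith
  \<comment> \<open>Squeezing can only raise the stationary occupation above its vacuum value
    \<open>1 / 2\<close>, which bounds the gain from below by a multiple of
    \<open>\<tau>\<close>.\<close>
  have "\<eta> * 1 \<le> \<eta> * cosh (2 * r)"
    using assms cosh_real_ge_1 by (intro mult_left_mono) auto
  then have "1 / 2 \<le> J_stat \<eta> r"
    using d by (simp add: J_stat_def field_simps)
  then have "\<eta> * \<tau> * (1 / 2) \<le> \<eta> * \<tau> * J_stat \<eta> r"
    using assms \<tau> by (intro mult_left_mono) auto
  then have gain: "\<eta> * \<tau> / 2 \<le> \<bar>fir_gain \<eta> r\<bar>"
    unfolding fir_gain_eq[OF assms r guard] sinh by linarith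
  have "0 < \<eta> * \<tau> / 2" using assms \<tau> by simp
  with gain have "1 / \<bar>fir_gain \<eta> r\<bar> \<le> 1 / (\<eta> * \<tau> / 2)" by (intro frac_le) auto
  then have "4 * k * (1 / \<bar>fir_gain \<eta> r\<bar>) / t \<le> 4 * k * (1 / (\<eta> * \<tau> / 2)) / t"
    using k \<epsilon> unfolding t_def by (intro divide_right_mono mult_left_mono) auto
  then have "(4 * k * (1 / \<bar>fir_gain \<eta> r\<bar>) / t)\<^sup>2 * (\<sigma>\<^sup>2 / (\<mu>\<^sup>2 * B))
      \<le> (4 * k * (1 / (\<eta> * \<tau> / 2)) / t)\<^sup>2 * (\<sigma>\<^sup>2 / (\<mu>\<^sup>2 * B))"
    using k \<epsilon> B by (intro mult_right_mono power_mono) (auto simp: t_def)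
  also have "\<dots> = 2 ^ 16 * k\<^sup>2 / (\<epsilon>\<^sup>2 * \<eta>\<^sup>2 * \<tau>\<^sup>2) * (\<sigma>\<^sup>2 / (\<mu>\<^sup>2 * B))"
    by (simp add: t_def power_mult_distrib power_divide)
  also have "\<dots> = 2"
  proof -
    \<comment> \<open>The variable \<open>e\<close> stands for \<open>1 - \<eta>\<close>, so that
      the field simplification treats it as an atom.\<close>
    have "2 ^ 16 * k\<^sup>2 / (\<epsilon>\<^sup>2 * \<eta>\<^sup>2 * (e\<^sup>2 * \<epsilon> / (256 * k)))
        * (\<sigma>\<^sup>2 / (\<mu>\<^sup>2 * (2 ^ 23 / (\<eta>\<^sup>2 * e\<^sup>2) * (\<sigma> / \<mu>)\<^sup>2 * k ^ 3 / \<epsilon> ^ 3))) = 2" if "0 < e" for e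
      using that assms noise k \<epsilon> by (simp add: field_simps power2_eq_square power3_eq_cube)
    from this[of "1 - \<eta>"] show ?thesis
      unfolding \<tau>_sq B_def c_def using assms by simp
  qed
  finally have var: "(4 * k * (1 / \<bar>fir_gain \<eta> r\<bar>) / t)\<^sup>2 * (\<sigma>\<^sup>2 / (\<mu>\<^sup>2 * B)) \<le> 2" .
  have t: "0 < t" "t \<le> 1" using \<epsilon> by (simp_all add: t_def)
  have "0 < weight n" using n by simp
  note mse = pattern_estimator_mse[OF assms r guard noise B n(1) this t
      bias[unfolded k_def] var[unfolded k_def], folded p_def]
  have "exp (4::real) = exp 1 ^ 4" by (simp flip: exp_of_nat_mult)
  also have "\<dots> \<le> 3 ^ 4" using exp_le by (intro power_mono) auto
  finally have "2 * exp 4 * t\<^sup>2 \<le> 2 * 3 ^ 4 * t\<^sup>2" by (intro mult_right_mono) auto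
  also have "\<dots> \<le> \<epsilon>\<^sup>2" using \<epsilon> by (simp add: t_def power_divide)
  finally have final: "sqrt x \<le> \<epsilon>" if "x \<le> 2 * exp 4 * t\<^sup>2" for x
    using that \<epsilon> by (intro real_le_lsqrt) auto
  \<comment> \<open>Under the guard \<open>v_inf\<close> is nonnegative, so multiplying the budget
    by this power can only enlarge it.\<close>
  have "1 \<le> (1 + v_inf \<eta> r) ^ (3 * (weight n - 1))"
    using assms guard by (intro one_le_power) (simp add: v_inf_def)
  then have "B * 1 \<le> B * (1 + v_inf \<eta> r) ^ (3 * (weight n - 1))"
    using B by (intro mult_left_mono) auto
  then have "B \<le> c * (\<sigma> / \<mu>)\<^sup>2 * k ^ 3 * (1 + v_inf \<eta> r) ^ (3 * (weight n - 1)) / \<epsilon> ^ 3"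
    by (simp add: B_def mult_ac)
  then show "\<exists>(\<phi>::nat \<Rightarrow> real) (r::real) (p::(nat + nat) cpoly) (B::real).
       guard_compatible \<eta> \<phi> r \<and>
       total_degree p = weight n \<and>
       0 < B \<and>
       B \<le> 2 ^ 23 / (\<eta>\<^sup>2 * (1 - \<eta>)\<^sup>2) * (\<sigma> / \<mu>)\<^sup>2 * real (weight n) ^ 3
             * (1 + v_inf \<eta> r) ^ (3 * (weight n - 1)) / \<epsilon> ^ 3 \<and>
       (\<forall>s\<in>inputs smax.
          integrable (readout_noise \<sigma> \<mu> B)
            (\<lambda>\<zeta>. (cmod (estimate p (measured_feature \<eta> \<beta> r \<phi> s \<zeta>) - pattern_exp \<beta> n s))\<^sup>2) \<and>
          sqrt (\<integral>\<zeta>. (cmod (estimate p (measured_feature \<eta> \<beta> r \<phi> s \<zeta>) - pattern_exp \<beta> n s))\<^sup>2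
                 \<partial>readout_noise \<sigma> \<mu> B) \<le> \<epsilon>)"
    \<comment> \<open>The error bounds hold for every mask; the zero mask is taken as
      witness.\<close>
    using r guard B mse final total_degree_pattern_monom[OF n(1)]
    by (intro exI[of _ "\<lambda>_. 0"] exI[of _ r] exI[of _ p] exI[of _ B] conjI ballI)
      (simp_all add: guard_compatible_def c_def k_def p_def)
qed

end
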